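(* Let $\varepsilon>0$, let $\rho_\varepsilon:\mathbb{R}^d\to[0,\infty]$ be a measurable kernel whose essential support is $\overline{B_\varepsilon(0)}$, and let $E\subset\mathbb{R}^d$ be a measurable set with finite $\mathbb{P}_\varepsilon$-perimeter. Then there exists a unique countable collection $\{E^{x_i}\}_{i\in I}$ of $\varepsilon$-connected components of $E$ such that each $E^{x_i}$ is $\varepsilon$-indecomposable, $|E^{x_i}|>0$ for every $i\in I$, $\bigcup_{i\in I}E^{x_i}=E^{(1)}$, and $$\mathbb{P}_\varepsilon(E)=\sum_{i\in I}\mathbb{P}_\varepsilon(E^{x_i}).$$
   Context: For measurable $E\subset\mathbb{R}^d$, $$\mathbb{P}_\varepsilon(E):=\int_{\mathbb{R}^d}\int_{\mathbb{R}^d}\frac{|\mathbf{1}_E(x)-\mathbf{1}_E(y)|}{|x-y|}\rho_\varepsilon(x-y)\,dx\,dy .$$ A set $E$ with $\mathbb{P}_\varepsilon(E)<\infty$ is $\varepsilon$-decomposable if there is a partition $\{E_1,E_2\}$ of $E$ into sets of finite $\mathbb{P}_\varepsilon$-perimeter with $|E_1|,|E_2|>0$ and $\mathbb{P}_\varepsilon(E)=\mathbb{P}_\varepsilon(E_1)+\mathbb{P}_\varepsilon(E_2)$; otherwise it is $\varepsilon$-indecomposable. $E^{(1)}:=\{x\in\mathbb{R}^d:\lim_{r\to0}|E\cap B_r(x)|/|B_r(x)|=1\}$ is the measure-theoretic interior. Points $x,y\in E^{(1)}$ are $\varepsilon$-connected in $E$ if there are $z_0,\dots,z_N\in E^{(1)}$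 with $z_0=x$, $z_N=y$ and $|z_i-z_{i+1}|<\varepsilon$ for all $i=0,\dots,N-1$. For $x\in E^{(1)}$, the $\varepsilon$-connected component of $E$ containing $x$ is $E^x:=\{y\in E^{(1)}: y\text{ is }\varepsilon\text{-connected to }x\text{ in }E\}$. "Countable" means finite (possibly empty) or countably infinite; a collection is understood without repetitions, i.e. $E^{x_i}\neq E^{x_j}$ for $i\neq j$. The essential support of $\rho_\varepsilon$ is the smallest closed set outside of which $\rho_\varepsilon=0$ a.e. *)

theory Defs
  imports "HOL-Analysis.Analysis"
begin

definition nl_perimeter :: "(real ^ 'd \<Rightarrow> ennreal) \<Rightarrow> (real ^ 'd) set \<Rightarrow> ennreal" where
  "nl_perimeter \<rho> E =
    (\<integral>\<^sup>+ y. (\<integral>\<^sup>+ x. ennreal (\<bar>indicator E x - indicator E y\<bar> / norm (x - y)) * \<rho> (x - y)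
       \<partial>lebesgue) \<partial>lebesgue)"

definition finite_perimeter :: "(real ^ 'd \<Rightarrow> ennreal) \<Rightarrow> (real ^ 'd) set \<Rightarrow> bool" where
  "finite_perimeter \<rho> E \<longleftrightarrow> E \<in> sets lebesgue \<and> nl_perimeter \<rho> E < \<infinity>"

definition decomposable :: "(real ^ 'd \<Rightarrow> ennreal) \<Rightarrow> (real ^ 'd) set \<Rightarrow> bool" where
  "decomposable \<rho> E \<longleftrightarrow> finite_perimeter \<rho> E \<and>
    (\<exists>E1 E2. E1 \<union> E2 = E \<and> E1 \<inter> E2 = {} \<and>
       finite_perimeter \<rho> E1 \<and> finite_perimeter \<rho> E2 \<and>
       emeasure lebesgue E1 > 0 \<and> emeasure lebesgue E2 > 0 \<and>
       nl_perimeter \<rho> E = nl_perimeter \<rho> E1 + nl_perimeter \<rho> E2)"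

text \<open>As in the mathematics, both notions apply only to sets of finite perimeter, so an
  indecomposable set has finite perimeter by definition.\<close>

definition indecomposable :: "(real ^ 'd \<Rightarrow> ennreal) \<Rightarrow> (real ^ 'd) set \<Rightarrow> bool" where
  "indecomposable \<rho> E \<longleftrightarrow> finite_perimeter \<rho> E \<and> \<not> decomposable \<rho> E"

definition mt_interior :: "(real ^ 'd) set \<Rightarrow> (real ^ 'd) set" where
  "mt_interior E =
    {x. ((\<lambda>r. measure lebesgue (E \<inter> ball x r) / measure lebesgue (ball x r)) \<longlongrightarrow> 1)
          (at_right 0)}"

definition eps_connected ::
    "real \<Rightarrow> (real ^ 'd) set \<Rightarrow> real ^ 'd \<Rightarrow> real ^ 'd \<Rightarrow> bool" where
  "eps_connected \<epsilon> E x y \<longleftrightarrow>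
    (\<exists>(N::nat) z. (\<forall>i\<le>N. z i \<in> mt_interior E) \<and> z 0 = x \<and> z N = y \<and>
       (\<forall>i<N. norm (z i - z (Suc i)) < \<epsilon>))"

definition eps_component :: "real \<Rightarrow> (real ^ 'd) set \<Rightarrow> real ^ 'd \<Rightarrow> (real ^ 'd) set" where
  "eps_component \<epsilon> E x = {y \<in> mt_interior E. eps_connected \<epsilon> E y x}"

definition eps_components :: "real \<Rightarrow> (real ^ 'd) set \<Rightarrow> (real ^ 'd) set set" where
  "eps_components \<epsilon> E = eps_component \<epsilon> E ` mt_interior E"

definition ess_support :: "(real ^ 'd \<Rightarrow> ennreal) \<Rightarrow> (real ^ 'd) set" where
  "ess_support f = \<Inter> {S. closed S \<and> (AE x in lebesgue. x \<notin> S \<longrightarrow> f x = 0)}"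

text \<open>The intersection belongs to the family, so it is the smallest such closed set.\<close>

lemma ess_support_least:
  fixes f :: "real ^ 'd \<Rightarrow> ennreal"
  shows "closed (ess_support f)"
    and "AE x in lebesgue. x \<notin> ess_support f \<longrightarrow> f x = 0"
    and "\<And>S. closed S \<Longrightarrow> (AE x in lebesgue. x \<notin> S \<longrightarrow> f x = 0) \<Longrightarrow> ess_support f \<subseteq> S"
proof -
  define F where "F = {S. closed S \<and> (AE x in lebesgue. x \<notin> S \<longrightarrow> f x = 0)}"
  show "closed (ess_support f)"
    unfolding ess_support_def by (intro closed_Inter) auto
  show "\<And>S. closed S \<Longrightarrow> (AE x in lebesgue. x \<notin> S \<longrightarrow> f x = 0) \<Longrightarrow> ess_support f \<subseteq> S"
    unfolding ess_support_def by auto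
  obtain G where G: "G \<subseteq> uminus ` F" "countable G" "\<Union> G = \<Union> (uminus ` F)"
    using Lindelof[of "uminus ` F"] unfolding F_def by (auto simp: open_Compl)
  have "AE x in lebesgue. \<forall>U\<in>G. x \<in> U \<longrightarrow> f x = 0"
    using G(1) unfolding AE_ball_countable[OF G(2)] F_def by auto
  moreover have "x \<in> \<Union> G" if "x \<notin> ess_support f" for x
    using that unfolding G(3) ess_support_def F_def by auto
  ultimately show "AE x in lebesgue. x \<notin> ess_support f \<longrightarrow> f x = 0"
    by (auto elim!: eventually_mono)
qed

end

theory Submission
  imports Defs
begin

text \<open>
  The components are the classes of an equivalence relation on the measure-theoretic interior of
  \<open>E\<close>, so the only collection of components that covers it consists of all of them. It remains to
  see that this collection has the required properties.

  By Lebesgue's density theorem the interior differs from \<open>E\<close> by a null set and therefore has the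
  same perimeter. Distinct components are at distance at least \<open>\<epsilon>\<close>. Hence there are only
  countably many, each is the intersection of the interior with an open set, and each has positive
  measure near every one of its points (\<open>eps_component_Int_ball_pos\<close>).

  The perimeter of a set is its interaction with its complement, in both orders, for the kernel
  \<open>\<rho> z / norm z\<close>. Distinct components do not interact, since the kernel vanishes almost everywhere
  beyond distance \<open>\<epsilon>\<close>, and countable additivity of the interaction gives the sum formula
  (\<open>nl_perimeter_Union_of_far_sets\<close>).

  For indecomposability, the perimeters of two disjoint sets exceed the perimeter of their union by
  twice their mutual interaction (\<open>nl_perimeter_add_eq\<close>). The parts of a decomposition thus do not
  interact. The decisive fact is \<open>interaction_pos_if_density_points_near\<close>: two sets with
  density points at distance less than \<open>\<epsilon>\<close> do interact, although the kernel may vanish on large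
  parts of its support. So the density points of the two parts stay \<open>\<epsilon>\<close> apart, and no chain with
  steps shorter than \<open>\<epsilon>\<close> connects them inside a component
  (\<open>indecomposable_eps_component\<close>).
\<close>

section \<open>Lebesgue density\<close>

text \<open>The density argument behind Lebesgue's theorem. If every point of \<open>A\<close> has arbitrarily small
  balls that \<open>E\<close> fills to at most the proportion \<open>t\<close>, then Vitali's theorem covers almost all of
  \<open>A\<close> by disjoint such balls inside an open set of measure at most \<open>m + e\<close>, where \<open>m\<close> is the outer
  measure of \<open>A\<close>. As \<open>A \<subseteq> E\<close>, this gives \<open>m \<le> t (m + e)\<close>, so \<open>m = 0\<close> once \<open>m\<close> is finite, which is
  why \<open>A\<close> is first cut into bounded pieces. The outer measure spares the question whether \<open>A\<close> is
  measurable.\<close>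

lemma negligible_of_lower_density_less_1:
  fixes A E :: "'a::euclidean_space set"
  assumes E: "E \<in> sets lebesgue" and AE: "A \<subseteq> E" and t: "0 \<le> t" "t < 1"
    and small: "\<And>x d. x \<in> A \<Longrightarrow> 0 < d \<Longrightarrow>
      \<exists>r. 0 < r \<and> r < d \<and> measure lebesgue (E \<inter> ball x r) \<le> t * measure lebesgue (ball x r)"
  shows "negligible A"
proof -
  have bounded_case: "negligible A'" if A': "A' \<subseteq> A" "A' \<subseteq> ball 0 (real n)" for A' n
  proof -
    define m where "m = outer_measure_of lebesgue A'"
    have "m \<le> emeasure lebesgue (ball (0::'a) (real n))"
      unfolding m_def using outer_measure_of_mono[OF A'(2), of lebesgue] by simp
    also have "\<dots> < \<infinity>"
      using emeasure_lborel_ball_finite[of "0::'a" "real n"] by simp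
    finally have m_fin: "m < \<infinity>" .
    obtain M where M: "M \<in> sets lebesgue" "A' \<subseteq> M" "emeasure lebesgue M = m"
      using outer_measure_of_attain[of A' lebesgue] unfolding m_def by auto
    have step: "m \<le> ennreal t * (m + ennreal e)" if e: "e > 0" for e
    proof -
      obtain T where T: "open T" "M \<subseteq> T" "T - M \<in> lmeasurable" "emeasure lebesgue (T - M) < ennreal e"
        using sets_lebesgue_outer_open[OF M(1) e] by blast
      have T_sets: "T \<in> sets lebesgue" using T(1) by auto
      define K where "K = {(x, r). x \<in> A' \<and> 0 < r \<and> ball x r \<subseteq> T \<and>
        measure lebesgue (E \<inter> ball x r) \<le> t * measure lebesgue (ball x r)}"
      obtain C where C: "countable C" "C \<subseteq> K"
        and disj: "pairwise (\<lambda>i j. disjnt (ball (fst i) (snd i)) (ball (fst j) (snd j))) C"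
        and neg: "negligible (A' - (\<Union>i\<in>C. ball (fst i) (snd i)))"
      proof (rule Vitali_covering_theorem_balls[of A' K fst snd])
        fix x and d :: real assume x: "x \<in> A'" and d: "0 < d"
        obtain k where k: "k > 0" "ball x k \<subseteq> T"
          using T(1,2) M(2) x by (meson open_contains_ball subsetD)
        obtain r where r: "0 < r" "r < min d k" "measure lebesgue (E \<inter> ball x r) \<le> t * measure lebesgue (ball x r)"
          using small[of x "min d k"] x A'(1) d k(1) by auto
        have "ball x r \<subseteq> T" using r(2) k(2) by (auto simp: subset_iff)
        then show "\<exists>i. i \<in> K \<and> x \<in> ball (fst i) (snd i) \<and> snd i < d"
          using r x by (intro exI[of _ "(x, r)"]) (auto simp: K_def)
      qed
      let ?B = "\<lambda>i. ball (fst i) (snd i) :: 'a set"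
      have disj1: "disjoint_family_on ?B C"
        using disj unfolding disjoint_family_on_def pairwise_def disjnt_def by blast
      then have disj2: "disjoint_family_on (\<lambda>i. E \<inter> ?B i) C"
        unfolding disjoint_family_on_def by blast
      have ball_le: "emeasure lebesgue (E \<inter> ?B i) \<le> ennreal t * emeasure lebesgue (?B i)" if "i \<in> C" for i
      proof -
        have "?B i \<in> lmeasurable" "E \<inter> ?B i \<in> lmeasurable"
          using E by (auto intro: fmeasurable_Int_fmeasurable simp: Int_commute[of E])
        then have "emeasure lebesgue (?B i) = measure lebesgue (?B i)"
           "emeasure lebesgue (E \<inter> ?B i) = measure lebesgue (E \<inter> ?B i)"
          by (auto simp: emeasure_eq_measure2)
        moreover have "measure lebesgue (E \<inter> ?B i) \<le> t * measure lebesgue (?B i)"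
          using that C(2) by (auto simp: K_def)
        ultimately show ?thesis
          using t by (simp only:) (simp add: ennreal_mult'[symmetric])
      qed
      have "m \<le> outer_measure_of lebesgue ((A' - (\<Union>i\<in>C. ?B i)) \<union> (\<Union>i\<in>C. E \<inter> ?B i))"
        unfolding m_def using A'(1) AE by (intro outer_measure_of_mono) auto
      also have "\<dots> = emeasure lebesgue ((A' - (\<Union>i\<in>C. ?B i)) \<union> (\<Union>i\<in>C. E \<inter> ?B i))"
        using neg E C(1) by (intro outer_measure_of_eq sets.Un sets.countable_UN')
          (auto simp: negligible_iff_null_sets)
      also have "\<dots> = emeasure lebesgue (\<Union>i\<in>C. E \<inter> ?B i)"
        using neg E C(1) by (subst Un_commute, intro emeasure_Un_null_set sets.countable_UN')
          (auto simp: negligible_iff_null_sets)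
      also have "\<dots> = (\<integral>\<^sup>+i. emeasure lebesgue (E \<inter> ?B i) \<partial>count_space C)"
        using E C(1) disj2 by (intro emeasure_UN_countable) auto
      also have "\<dots> \<le> (\<integral>\<^sup>+i. ennreal t * emeasure lebesgue (?B i) \<partial>count_space C)"
        using ball_le by (intro nn_integral_mono) auto
      also have "\<dots> = ennreal t * (\<integral>\<^sup>+i. emeasure lebesgue (?B i) \<partial>count_space C)"
        by (intro nn_integral_cmult) auto
      also have "(\<integral>\<^sup>+i. emeasure lebesgue (?B i) \<partial>count_space C) = emeasure lebesgue (\<Union>i\<in>C. ?B i)"
        using C(1) disj1 by (intro emeasure_UN_countable[symmetric]) auto
      also have "\<dots> \<le> emeasure lebesgue T"
      proof (intro emeasure_mono UN_least T_sets)
        fix i assume "i \<in> C"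
        then have "i \<in> K" using C(2) by blast
        then show "?B i \<subseteq> T" by (cases i) (simp add: K_def)
      qed
      also have "\<dots> = emeasure lebesgue M + emeasure lebesgue (T - M)"
        using M(1) T(2,3) by (subst plus_emeasure) (auto intro: arg_cong[where f = "emeasure lebesgue"])
      also have "\<dots> \<le> m + ennreal e"
        using M(3) T(4) by (intro add_mono) auto
      finally show ?thesis by (simp add: mult_left_mono)
    qed
    obtain m' where m': "m = ennreal m'" "m' \<ge> 0"
      using m_fin by (cases m) auto
    have m'_le: "m' \<le> t * (m' + e)" if "e > 0" for e
    proof -
      have "ennreal m' \<le> ennreal (t * (m' + e))"
        using step[OF that] m' t(1) that by (simp add: ennreal_mult' ennreal_plus)
      then show ?thesis
        using m'(2) t(1) that by (subst (asm) ennreal_le_iff) auto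
    qed
    have le: "m' * (1 - t) \<le> 0 + e" if "e > 0" for e
    proof -
      have "m' \<le> t * (m' + e)" using m'_le[OF that] .
      moreover have "t * e \<le> 1 * e" using t that by (intro mult_right_mono) auto
      ultimately show ?thesis by (simp add: algebra_simps)
    qed
    have "m' * (1 - t) \<le> 0" using le by (rule field_le_epsilon)
    then have "m' = 0" using m'(2) t(2) by (simp add: mult_le_0_iff)
    then have "emeasure lebesgue M = 0" using M(3) m' by simp
    then have "negligible M" using M(1) by (simp add: negligible_iff_emeasure0)
    then show ?thesis using M(2) negligible_subset by blast
  qed
  have "A = (\<Union>n. A \<inter> ball 0 (real n))"
    using reals_Archimedean2 by auto
  moreover have "negligible (\<Union>n. A \<inter> ball 0 (real n))"
  proof (intro negligible_countable_Union)
    fix S assume "S \<in> range (\<lambda>n. A \<inter> ball 0 (real n))"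
    then obtain n where "S = A \<inter> ball 0 (real n)" by blast
    then show "negligible S" using bounded_case[of S n] by simp
  qed auto
  ultimately show ?thesis by simp
qed

text \<open>The form in which membership in the measure-theoretic interior is used: no quotient, and one
  threshold for all small radii.\<close>

lemma density_gt_at_mt_interior:
  fixes E :: "(real ^ 'd) set"
  assumes "x \<in> mt_interior E" "t < 1"
  obtains \<delta> where "\<delta> > 0"
    "\<And>r. 0 < r \<Longrightarrow> r < \<delta> \<Longrightarrow> t * measure lebesgue (ball x r) < measure lebesgue (E \<inter> ball x r)"
proof -
  have "eventually (\<lambda>r. t < measure lebesgue (E \<inter> ball x r) / measure lebesgue (ball x r)) (at_right 0)"
    using assms by (auto simp: mt_interior_def intro: order_tendstoD)
  then obtain \<delta> where \<delta>: "\<delta> > 0"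
    "\<And>r. 0 < r \<Longrightarrow> r < \<delta> \<Longrightarrow> t < measure lebesgue (E \<inter> ball x r) / measure lebesgue (ball x r)"
    by (auto simp: eventually_at_right_field)
  show thesis
  proof
    fix r :: real assume r: "0 < r" "r < \<delta>"
    have "measure lebesgue (ball x r) > 0" using r(1) by (simp add: content_ball_pos)
    then show "t * measure lebesgue (ball x r) < measure lebesgue (E \<inter> ball x r)"
      using \<delta>(2)[OF r] by (simp add: pos_less_divide_eq)
  qed (fact \<delta>(1))
qed

text \<open>At a point of \<open>E\<close> without density one, the quotient is at most \<open>1 - 1 / (n + 1)\<close> along
  arbitrarily small radii, for some \<open>n\<close>. The exceptional points are a countable union of sets of the kind just
  treated.\<close>

lemma negligible_diff_mt_interior:
  fixes E :: "(real ^ 'd) set"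
  assumes E: "E \<in> sets lebesgue"
  shows "negligible (E - mt_interior E)"
proof -
  define bad where "bad n = {x \<in> E. \<forall>d>0. \<exists>r>0. r < d \<and>
     measure lebesgue (E \<inter> ball x r) \<le> (1 - 1 / real (Suc n)) * measure lebesgue (ball x r)}" for n
  have "negligible (bad n)" for n
    by (rule negligible_of_lower_density_less_1[OF E, of _ "1 - 1 / real (Suc n)"])
      (auto simp: bad_def divide_simps)
  moreover have "E - mt_interior E \<subseteq> (\<Union>n. bad n)"
  proof
    fix x assume x: "x \<in> E - mt_interior E"
    show "x \<in> (\<Union>n. bad n)"
    proof (rule ccontr)
      assume not_bad: "x \<notin> (\<Union>n. bad n)"
      let ?q = "\<lambda>r. measure lebesgue (E \<inter> ball x r) / measure lebesgue (ball x r)"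
      have "(?q \<longlongrightarrow> 1) (at_right 0)"
      proof (rule order_tendstoI)
        fix a :: real assume "a < 1"
        then obtain n where n: "1 / real (Suc n) < 1 - a"
          using nat_approx_posE[of "1 - a"] by auto
        have "x \<in> E" "x \<notin> bad n" using x not_bad by auto
        then have "\<exists>d>0. \<forall>r>0. r < d \<longrightarrow>
            \<not> measure lebesgue (E \<inter> ball x r) \<le> (1 - 1 / real (Suc n)) * measure lebesgue (ball x r)"
          unfolding bad_def mem_Collect_eq by blast
        then obtain d where d: "d > 0" "\<And>r. 0 < r \<Longrightarrow> r < d \<Longrightarrow>
            (1 - 1 / real (Suc n)) * measure lebesgue (ball x r) < measure lebesgue (E \<inter> ball x r)"
          unfolding not_le by blast
        have "a < ?q r" if r: "0 < r" "r < d" for r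
        proof -
          have pos: "measure lebesgue (ball x r) > 0" using r(1) by (simp add: content_ball_pos)
          have "a < 1 - 1 / real (Suc n)" using n by simp
          also have "\<dots> < ?q r" using d(2)[OF r] pos by (simp add: pos_less_divide_eq)
          finally show ?thesis .
        qed
        then show "eventually (\<lambda>r. a < ?q r) (at_right 0)"
          using d(1) by (auto simp: eventually_at_right_field)
      next
        fix a :: real assume a: "1 < a"
        have "?q r < a" if r: "0 < r" for r
        proof -
          have pos: "measure lebesgue (ball x r) > 0" using r by (simp add: content_ball_pos)
          have "measure lebesgue (E \<inter> ball x r) \<le> measure lebesgue (ball x r)"
            using E by (intro measure_mono_fmeasurable) auto
          then have "?q r \<le> 1" using pos by (simp add: pos_divide_le_eq)
          then show ?thesis using a by simp
        qed
        then show "eventually (\<lambda>r. ?q r < a) (at_right 0)"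
          by (auto simp: eventually_at_right_field intro: exI[of _ 1])
      qed
      then show False using x by (simp add: mt_interior_def)
    qed
  qed
  moreover from calculation(1) have "negligible (\<Union>n. bad n)"
    by (intro negligible_countable_Union) auto
  ultimately show ?thesis using negligible_subset by blast
qed

text \<open>Where \<open>E\<close> has density one, its complement has density zero. At points outside \<open>E\<close> this is the
  situation of the covering argument applied to the complement.\<close>

lemma negligible_mt_interior_diff:
  fixes E :: "(real ^ 'd) set"
  assumes E: "E \<in> sets lebesgue"
  shows "negligible (mt_interior E - E)"
proof (rule negligible_of_lower_density_less_1[of "- E" _ "1/2"])
  show "- E \<in> sets lebesgue" using E by (rule Compl_in_sets_lebesgue[THEN iffD2])
  fix x and d :: real assume x: "x \<in> mt_interior E - E" and d: "0 < d"
  obtain \<delta> where \<delta>: "\<delta> > 0"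
    "\<And>r. 0 < r \<Longrightarrow> r < \<delta> \<Longrightarrow> 1/2 * measure lebesgue (ball x r) < measure lebesgue (E \<inter> ball x r)"
    using x by (auto intro: density_gt_at_mt_interior[of x E "1/2"])
  obtain r where r: "0 < r" "r < min d \<delta>" using d \<delta>(1) by (metis dense min_less_iff_conj)
  have "measure lebesgue (- E \<inter> ball x r) = measure lebesgue (ball x r - E \<inter> ball x r)"
    by (rule arg_cong[where f = "measure lebesgue"]) auto
  also have "\<dots> = measure lebesgue (ball x r) - measure lebesgue (E \<inter> ball x r)"
    using E by (intro measurable_measure_Diff) auto
  finally show "\<exists>r. 0 < r \<and> r < d \<and> measure lebesgue (- E \<inter> ball x r) \<le> 1/2 * measure lebesgue (ball x r)"
    using r \<delta>(2)[of r] by (intro exI[of _ r]) auto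
qed auto

lemma AE_mem_mt_interior_iff:
  fixes E :: "(real ^ 'd) set"
  assumes E: "E \<in> sets lebesgue"
  shows "AE x in lebesgue. x \<in> mt_interior E \<longleftrightarrow> x \<in> E"
proof (rule AE_I')
  show "(mt_interior E - E) \<union> (E - mt_interior E) \<in> null_sets lebesgue"
    using negligible_diff_mt_interior[OF E] negligible_mt_interior_diff[OF E]
    by (auto simp: negligible_iff_null_sets)
qed auto

lemma mt_interior_in_sets_lebesgue:
  fixes E :: "(real ^ 'd) set"
  assumes E: "E \<in> sets lebesgue"
  shows "mt_interior E \<in> sets lebesgue"
proof -
  have "mt_interior E = (E - (E - mt_interior E)) \<union> (mt_interior E - E)" by auto
  then show ?thesis
    using E negligible_diff_mt_interior[OF E] negligible_mt_interior_diff[OF E]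
    by (metis negligible_imp_sets sets.Diff sets.Un)
qed

lemma ex_density_point:
  fixes A :: "(real ^ 'd) set"
  assumes A: "A \<in> sets lebesgue" and pos: "emeasure lebesgue (A \<inter> U) > 0"
  obtains x where "x \<in> A" "x \<in> U" "x \<in> mt_interior A"
proof -
  have "\<not> A \<inter> U \<subseteq> A - mt_interior A"
  proof
    assume "A \<inter> U \<subseteq> A - mt_interior A"
    then have "negligible (A \<inter> U)"
      using negligible_diff_mt_interior[OF A] negligible_subset by blast
    then show False using pos by (auto simp: negligible_iff_null_sets)
  qed
  then show thesis using that by blast
qed

section \<open>Interaction energies\<close>

text \<open>The mass that the kernel \<open>K\<close> sees between \<open>A\<close> and \<open>B\<close>. The nonlocal perimeter is the sum of two
  such terms, and unlike the perimeter this quantity is additive in each set separately.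
  The kernel need not be even, so the order of the two arguments matters.\<close>

definition interaction :: "('a::euclidean_space \<Rightarrow> ennreal) \<Rightarrow> 'a set \<Rightarrow> 'a set \<Rightarrow> ennreal" where
  "interaction K A B = (\<integral>\<^sup>+y\<in>B. (\<integral>\<^sup>+x\<in>A. K (x - y) \<partial>lebesgue) \<partial>lebesgue)"

lemma AE_lebesgue_translate:
  fixes c :: "'a::euclidean_space"
  assumes "AE z in lebesgue. P z"
  shows "AE x in lebesgue. P (x - c)"
proof -
  obtain N where N: "N \<in> null_sets lebesgue" "{z. \<not> P z} \<subseteq> N"
    using assms by (auto elim!: AE_E2 simp: eventually_ae_filter)
  then have "(+) c ` N \<in> null_sets lebesgue"
    using negligible_translation[of N c] by (simp add: negligible_iff_null_sets)
  moreover have "{x. \<not> P (x - c)} \<subseteq> (+) c ` N"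
  proof
    fix x assume "x \<in> {x. \<not> P (x - c)}"
    then have "x - c \<in> N" using N(2) by auto
    then show "x \<in> (+) c ` N" by (intro image_eqI[of _ _ "x - c"]) auto
  qed
  ultimately show ?thesis by (intro AE_I') auto
qed

lemma borel_measurable_lebesgue_translate:
  fixes K :: "'a::euclidean_space \<Rightarrow> ennreal"
  assumes K: "K \<in> borel_measurable lebesgue"
  shows "(\<lambda>x. K (x - y)) \<in> borel_measurable lebesgue"
proof -
  have "(\<lambda>x. x - y) \<in> lebesgue \<rightarrow>\<^sub>M lebesgue"
  proof (rule measurableI)
    fix S :: "'a set" assume S: "S \<in> sets lebesgue"
    have "(\<lambda>x. x - y) -` S \<inter> space lebesgue = (+) y ` S"
      by (auto intro!: image_eqI[where x = "_ - y"])
    then show "(\<lambda>x. x - y) -` S \<inter> space lebesgue \<in> sets lebesgue"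
      using lebesgue_sets_translation[OF S, of y] by simp
  qed simp
  then show ?thesis using K by (rule measurable_compose)
qed

text \<open>For a kernel that is merely Lebesgue measurable, \<open>K (x - y)\<close> need not be measurable as a function
  of the pair for the product of the two Lebesgue sigma-algebras, since that product is not complete.
  Tonelli's theorem is therefore applied to Borel functions that agree almost everywhere with the
  given ones.\<close>

lemma ex_borel_version:
  fixes K :: "'a::euclidean_space \<Rightarrow> ennreal"
  assumes "K \<in> borel_measurable lebesgue"
  obtains K' where "K' \<in> borel_measurable borel" "AE x in lebesgue. K x = K' x"
  using completion_ex_borel_measurable[OF assms] by (auto simp: AE_completion_iff)

text \<open>Since null sets are translation invariant, passing to Borel versions leaves the inner integral
  unchanged at every single \<open>y\<close>, not only at almost every one. This is what makes it a Borel function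
  of \<open>y\<close>.\<close>

lemma interaction_inner_eq_borel:
  fixes K :: "'a::euclidean_space \<Rightarrow> ennreal"
  assumes "AE z in lebesgue. K z = K' z" and "AE x in lebesgue. indicator A x = (a x :: ennreal)"
  shows "(\<integral>\<^sup>+x\<in>A. K (x - y) \<partial>lebesgue) = (\<integral>\<^sup>+x. K' (x - y) * a x \<partial>lborel)"
proof -
  have "(\<integral>\<^sup>+x\<in>A. K (x - y) \<partial>lebesgue) = (\<integral>\<^sup>+x. K' (x - y) * a x \<partial>lebesgue)"
    using AE_lebesgue_translate[OF assms(1), of y] assms(2)
    by (intro nn_integral_cong_AE) (auto elim!: eventually_elim2)
  then show ?thesis by (simp add: nn_integral_completion)
qed

lemma borel_measurable_interaction_inner:
  fixes K :: "'a::euclidean_space \<Rightarrow> ennreal"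
  assumes K: "K \<in> borel_measurable lebesgue" and A: "A \<in> sets lebesgue"
  shows "(\<lambda>y. \<integral>\<^sup>+x\<in>A. K (x - y) \<partial>lebesgue) \<in> borel_measurable lebesgue"
proof -
  obtain K' where K': "K' \<in> borel_measurable borel" "AE x in lebesgue. K x = K' x"
    using ex_borel_version[OF K] .
  obtain a :: "'a \<Rightarrow> ennreal" where a: "a \<in> borel_measurable borel" "AE x in lebesgue. indicator A x = a x"
    using ex_borel_version[of "indicator A"] A by auto
  note [measurable] = K'(1) a(1)
  have "(\<lambda>y. \<integral>\<^sup>+x. K' (x - y) * a x \<partial>lborel) \<in> borel_measurable lborel"
    by measurable
  then show ?thesis
    by (simp only: interaction_inner_eq_borel[OF K'(2) a(2)] measurable_completion)
qed

lemma interaction_cong_AE: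
  assumes "AE x in lebesgue. x \<in> A \<longleftrightarrow> x \<in> A'" "AE x in lebesgue. x \<in> B \<longleftrightarrow> x \<in> B'"
  shows "interaction K A B = interaction K A' B'"
proof -
  have "(\<integral>\<^sup>+x\<in>A. K (x - y) \<partial>lebesgue) = (\<integral>\<^sup>+x\<in>A'. K (x - y) \<partial>lebesgue)" for y
    using assms(1) by (intro nn_integral_cong_AE) (auto elim!: eventually_mono split: split_indicator)
  then show ?thesis
    unfolding interaction_def
    using assms(2) by (simp, intro nn_integral_cong_AE) (auto elim!: eventually_mono split: split_indicator)
qed

lemma indicator_Union_count_space:
  assumes "disjoint \<C>"
  shows "indicator (\<Union>\<C>) x = (\<integral>\<^sup>+C. indicator C x \<partial>count_space \<C>)"
proof (cases "x \<in> \<Union>\<C>")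
  case True
  then obtain D where D: "D \<in> \<C>" "x \<in> D" by blast
  then have "indicator C x = (indicator {D} C :: ennreal)" if "C \<in> \<C>" for C
    using assms that by (auto simp: indicator_def disjoint_def)
  moreover have "indicator (\<Union>\<C>) x = (1 :: ennreal)" using True by simp
  ultimately show ?thesis
    using D by (simp cong: nn_integral_cong_simp)
qed (auto simp: nn_integral_0_iff_AE AE_count_space)

lemma interaction_Union_left:
  assumes K: "K \<in> borel_measurable lebesgue"
    and \<C>: "countable \<C>" "disjoint \<C>" "\<C> \<subseteq> sets lebesgue" and B: "B \<in> sets lebesgue"
  shows "interaction K (\<Union>\<C>) B = (\<integral>\<^sup>+C. interaction K C B \<partial>count_space \<C>)"
proof -
  have inner: "(\<integral>\<^sup>+x\<in>\<Union>\<C>. K (x - y) \<partial>lebesgue) = (\<integral>\<^sup>+C. (\<integral>\<^sup>+x\<in>C. K (x - y) \<partial>lebesgue) \<partial>count_space \<C>)" for y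
  proof -
    have "(\<integral>\<^sup>+x\<in>\<Union>\<C>. K (x - y) \<partial>lebesgue)
        = (\<integral>\<^sup>+x. (\<integral>\<^sup>+C. K (x - y) * indicator C x \<partial>count_space \<C>) \<partial>lebesgue)"
      by (simp add: indicator_Union_count_space[OF \<C>(2)] nn_integral_cmult)
    also have "\<dots> = (\<integral>\<^sup>+C. (\<integral>\<^sup>+x\<in>C. K (x - y) \<partial>lebesgue) \<partial>count_space \<C>)"
      using \<C>(1,3) borel_measurable_lebesgue_translate[OF K]
      by (intro nn_integral_count_space_nn_integral) auto
    finally show ?thesis .
  qed
  have "interaction K (\<Union>\<C>) B
      = (\<integral>\<^sup>+y. (\<integral>\<^sup>+C. (\<integral>\<^sup>+x\<in>C. K (x - y) \<partial>lebesgue) * indicator B y \<partial>count_space \<C>) \<partial>lebesgue)"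
    by (simp add: interaction_def inner nn_integral_multc)
  also have "\<dots> = (\<integral>\<^sup>+C. interaction K C B \<partial>count_space \<C>)"
    unfolding interaction_def
    using \<C>(1,3) B borel_measurable_interaction_inner[OF K]
    by (intro nn_integral_count_space_nn_integral) auto
  finally show ?thesis .
qed

lemma interaction_Union_right:
  assumes K: "K \<in> borel_measurable lebesgue"
    and \<C>: "countable \<C>" "disjoint \<C>" "\<C> \<subseteq> sets lebesgue" and A: "A \<in> sets lebesgue"
  shows "interaction K A (\<Union>\<C>) = (\<integral>\<^sup>+C. interaction K A C \<partial>count_space \<C>)"
proof -
  have "interaction K A (\<Union>\<C>)
      = (\<integral>\<^sup>+y. (\<integral>\<^sup>+C. (\<integral>\<^sup>+x\<in>A. K (x - y) \<partial>lebesgue) * indicator C y \<partial>count_space \<C>) \<partial>lebesgue)"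
    by (simp add: interaction_def indicator_Union_count_space[OF \<C>(2)] nn_integral_cmult)
  also have "\<dots> = (\<integral>\<^sup>+C. interaction K A C \<partial>count_space \<C>)"
    unfolding interaction_def
    using \<C>(1,3) borel_measurable_interaction_inner[OF K A]
    by (intro nn_integral_count_space_nn_integral) auto
  finally show ?thesis .
qed

lemma interaction_empty [simp]: "interaction K {} B = 0" "interaction K A {} = 0"
  by (simp_all add: interaction_def)

lemma interaction_Un_left:
  assumes K: "K \<in> borel_measurable lebesgue" and "A1 \<in> sets lebesgue" "A2 \<in> sets lebesgue"
    and "A1 \<inter> A2 = {}" and "B \<in> sets lebesgue"
  shows "interaction K (A1 \<union> A2) B = interaction K A1 B + interaction K A2 B"
proof (cases "A1 = A2")
  case True
  then show ?thesis using assms(4) by simp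
next
  case False
  have "disjoint {A1, A2}" using assms(4) by (auto simp: disjoint_def)
  then show ?thesis
    using interaction_Union_left[OF K, of "{A1, A2}" B] assms False
    by (simp add: nn_integral_count_space_finite)
qed

lemma interaction_Un_right:
  assumes K: "K \<in> borel_measurable lebesgue" and "B1 \<in> sets lebesgue" "B2 \<in> sets lebesgue"
    and "B1 \<inter> B2 = {}" and "A \<in> sets lebesgue"
  shows "interaction K A (B1 \<union> B2) = interaction K A B1 + interaction K A B2"
proof (cases "B1 = B2")
  case True
  then show ?thesis using assms(4) by simp
next
  case False
  have "disjoint {B1, B2}" using assms(4) by (auto simp: disjoint_def)
  then show ?thesis
    using interaction_Union_right[OF K, of "{B1, B2}" A] assms False
    by (simp add: nn_integral_count_space_finite)
qed

lemma interaction_eq_0_if_far: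
  fixes K :: "'a::euclidean_space \<Rightarrow> ennreal"
  assumes K: "AE z in lebesgue. \<epsilon> \<le> norm z \<longrightarrow> K z = 0"
    and far: "\<And>x y. x \<in> A \<Longrightarrow> y \<in> B \<Longrightarrow> \<epsilon> \<le> dist x y"
  shows "interaction K A B = 0"
proof -
  have "(\<integral>\<^sup>+x\<in>A. K (x - y) \<partial>lebesgue) * indicator B y = 0" for y
  proof (cases "y \<in> B")
    case True
    have "AE x in lebesgue. K (x - y) * indicator A x = 0"
      using AE_lebesgue_translate[OF K, of y]
    proof eventually_elim
      case (elim x)
      then show ?case using far[OF _ True, of x] by (auto simp: dist_norm split: split_indicator)
    qed
    then have "(\<integral>\<^sup>+x\<in>A. K (x - y) \<partial>lebesgue) = (\<integral>\<^sup>+x. 0 \<partial>(lebesgue :: 'a measure))"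
      by (rule nn_integral_cong_AE)
    then show ?thesis by simp
  qed simp
  then show ?thesis unfolding interaction_def by (simp only: nn_integral_const mult_zero_left)
qed

text \<open>Substituting \<open>x = z + y\<close> and exchanging the integrals isolates the kernel: each displacement \<open>z\<close> is
  weighted by the measure of the overlap of \<open>B\<close> with \<open>A\<close> shifted by \<open>- z\<close>. The second claim is
  needed to conclude from a vanishing integral that the integrand vanishes almost everywhere.\<close>

lemma interaction_eq_overlap_integral:
  fixes K :: "'a::euclidean_space \<Rightarrow> ennreal"
  assumes K: "K \<in> borel_measurable lebesgue" and A: "A \<in> sets lebesgue" and B: "B \<in> sets lebesgue"
  shows "interaction K A B = (\<integral>\<^sup>+z. K z * emeasure lebesgue {y \<in> B. z + y \<in> A} \<partial>lebesgue)" (is ?integral)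
    and "(\<lambda>z. emeasure lebesgue {y \<in> B. z + y \<in> A}) \<in> borel_measurable lebesgue" (is ?measurable)
proof -
  obtain K' where K': "K' \<in> borel_measurable borel" "AE x in lebesgue. K x = K' x"
    using ex_borel_version[OF K] .
  obtain a :: "'a \<Rightarrow> ennreal" where a: "a \<in> borel_measurable borel" "AE x in lebesgue. indicator A x = a x"
    using ex_borel_version[of "indicator A"] A by auto
  obtain b :: "'a \<Rightarrow> ennreal" where b: "b \<in> borel_measurable borel" "AE x in lebesgue. indicator B x = b x"
    using ex_borel_version[of "indicator B"] B by auto
  note [measurable] = K'(1) a(1) b(1)
  have shift: "(\<integral>\<^sup>+x. K' (x - y) * a x \<partial>lborel) = (\<integral>\<^sup>+z. K' z * a (z + y) \<partial>lborel)" for y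
    by (subst lborel_distr_plus[of y, symmetric], subst nn_integral_distr) (auto simp: add.commute)
  have overlap: "(\<integral>\<^sup>+y. a (z + y) * b y \<partial>lborel) = emeasure lebesgue {y \<in> B. z + y \<in> A}" for z
  proof -
    have A': "AE y in lebesgue. indicator A (z + y) = a (z + y)"
      using AE_lebesgue_translate[OF a(2), of "- z"] by (simp add: add.commute)
    have "{y. z + y \<in> A} = (+) (- z) ` A"
      by (auto intro!: image_eqI[where x = "z + _"])
    then have "{y. z + y \<in> A} \<in> sets lebesgue"
      using lebesgue_sets_translation[OF A, of "- z"] by simp
    then have S: "{y \<in> B. z + y \<in> A} \<in> sets lebesgue"
      using B sets.Int[of B lebesgue "{y. z + y \<in> A}"] by (simp add: Collect_conj_eq)
    have "(\<integral>\<^sup>+y. a (z + y) * b y \<partial>lborel) = (\<integral>\<^sup>+y. a (z + y) * b y \<partial>lebesgue)"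
      by (simp add: nn_integral_completion)
    also have "\<dots> = (\<integral>\<^sup>+y. indicator {y \<in> B. z + y \<in> A} y \<partial>lebesgue)"
      using A' b(2) by (intro nn_integral_cong_AE, eventually_elim) (auto split: split_indicator_asm simp: indicator_def)
    finally show ?thesis using S by simp
  qed
  have "interaction K A B = (\<integral>\<^sup>+y. (\<integral>\<^sup>+x. K' (x - y) * a x \<partial>lborel) * indicator B y \<partial>lebesgue)"
    by (simp add: interaction_def interaction_inner_eq_borel[OF K'(2) a(2)])
  also have "\<dots> = (\<integral>\<^sup>+y. (\<integral>\<^sup>+x. K' (x - y) * a x \<partial>lborel) * b y \<partial>lebesgue)"
    using b(2) by (intro nn_integral_cong_AE) (auto elim!: eventually_mono)
  also have "\<dots> = (\<integral>\<^sup>+y. (\<integral>\<^sup>+z. K' z * (a (z + y) * b y) \<partial>lborel) \<partial>lborel)"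
    by (simp add: nn_integral_completion shift nn_integral_multc[symmetric] mult.assoc)
  also have "\<dots> = (\<integral>\<^sup>+z. (\<integral>\<^sup>+y. K' z * (a (z + y) * b y) \<partial>lborel) \<partial>lborel)"
    by (rule lborel_pair.Fubini') measurable
  also have "\<dots> = (\<integral>\<^sup>+z. K' z * emeasure lebesgue {y \<in> B. z + y \<in> A} \<partial>lborel)"
    by (simp add: nn_integral_cmult overlap)
  also have "\<dots> = (\<integral>\<^sup>+z. K' z * emeasure lebesgue {y \<in> B. z + y \<in> A} \<partial>lebesgue)"
    by (simp add: nn_integral_completion)
  also have "\<dots> = (\<integral>\<^sup>+z. K z * emeasure lebesgue {y \<in> B. z + y \<in> A} \<partial>lebesgue)"
    using K'(2) by (intro nn_integral_cong_AE) (auto elim!: eventually_mono)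
  finally show ?integral .
  have "(\<lambda>z. \<integral>\<^sup>+y. a (z + y) * b y \<partial>lborel) \<in> borel_measurable lborel"
    by measurable
  then show ?measurable
    by (simp only: overlap measurable_completion)
qed

text \<open>If \<open>z\<close> is close to \<open>a - b\<close>, then the pieces of \<open>A - z\<close> and \<open>B\<close> near \<open>b\<close> lie in one ball that is only
  slightly larger than \<open>ball b r\<close>, and each fills more than three quarters of the volume of
  \<open>ball b r\<close>. Two such pieces cannot be disjoint up to a null set if the larger ball has less than
  three halves of that volume. Density points thus replace the continuity of the convolution of two
  indicator functions.\<close>

lemma overlap_pos_near_difference_of_density_points:
  fixes A B :: "(real ^ 'd) set"
  assumes A: "A \<in> sets lebesgue" "a \<in> mt_interior A"
    and B: "B \<in> sets lebesgue" "b \<in> mt_interior B"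
  obtains \<eta> where "\<eta> > 0" "\<And>z. z \<in> ball (a - b) \<eta> \<Longrightarrow> emeasure lebesgue {y \<in> B. z + y \<in> A} > 0"
proof -
  obtain \<delta>A where \<delta>A: "\<delta>A > 0"
    "\<And>r. 0 < r \<Longrightarrow> r < \<delta>A \<Longrightarrow> 3/4 * measure lebesgue (ball a r) < measure lebesgue (A \<inter> ball a r)"
    using A(2) by (rule density_gt_at_mt_interior[where t = "3/4"]) auto
  obtain \<delta>B where \<delta>B: "\<delta>B > 0"
    "\<And>r. 0 < r \<Longrightarrow> r < \<delta>B \<Longrightarrow> 3/4 * measure lebesgue (ball b r) < measure lebesgue (B \<inter> ball b r)"
    using B(2) by (rule density_gt_at_mt_interior[where t = "3/4"]) auto
  define r where "r = min \<delta>A \<delta>B / 2"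
  have r: "0 < r" "r < \<delta>A" "r < \<delta>B"
    using \<delta>A(1) \<delta>B(1) by (auto simp: r_def min_def)
  define n where "n = DIM(real ^ 'd)"
  define v where "v = measure lebesgue (ball (0 :: real ^ 'd) 1)"
  have v: "v > 0" by (simp add: v_def content_ball_pos)
  have ball_vol: "measure lebesgue (ball (c :: real ^ 'd) s) = s ^ n * v" if "s \<ge> 0" for c s
    using content_ball_conv_unit_ball[OF that, of c] by (simp add: n_def v_def)
  have "((\<lambda>\<eta>. (r + \<eta>) ^ n) \<longlongrightarrow> (r + 0) ^ n) (at_right 0)"
    by (intro tendsto_intros)
  \<comment> \<open>\<open>X\<close> and \<open>Y\<close> below have total volume above \<open>3/4 + 3/4 = 3/2\<close> of a ball of radius \<open>r\<close>.\<close>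
  then have "eventually (\<lambda>\<eta>. (r + \<eta>) ^ n < 3/2 * r ^ n) (at_right 0)"
    using r(1) by (intro order_tendstoD) auto
  then obtain \<eta>' where "\<eta>' > 0" "\<And>\<eta>. 0 < \<eta> \<Longrightarrow> \<eta> < \<eta>' \<Longrightarrow> (r + \<eta>) ^ n < 3/2 * r ^ n"
    by (auto simp: eventually_at_right_field)
  then obtain \<eta> where \<eta>: "\<eta> > 0" "(r + \<eta>) ^ n < 3/2 * r ^ n"
    using dense by blast
  show thesis
  proof (rule that[OF \<eta>(1)])
    fix z assume z: "z \<in> ball (a - b) \<eta>"
    define X where "X = (+) (- z) ` (A \<inter> ball a r)"
    define Y where "Y = B \<inter> ball b r"
    have "A \<inter> ball a r \<in> lmeasurable"
      using A(1) by (auto intro: fmeasurable_Int_fmeasurable simp: Int_commute[of A])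
    then have X: "X \<in> lmeasurable" "measure lebesgue X > 3/4 * (r ^ n * v)"
      unfolding X_def measure_translation using \<delta>A(2)[OF r(1,2)] ball_vol[of r a] r(1)
      by (auto simp del: add_uminus_conv_diff uminus_add_conv_diff intro: measurable_translation)
    have Y: "Y \<in> lmeasurable" "measure lebesgue Y > 3/4 * (r ^ n * v)"
      unfolding Y_def using B(1) \<delta>B(2)[OF r(1,3)] ball_vol[of r b] r(1)
      by (auto intro: fmeasurable_Int_fmeasurable simp: Int_commute[of B])
    have "X \<union> Y \<subseteq> ball b (r + \<eta>)"
    proof
      fix y assume "y \<in> X \<union> Y"
      then show "y \<in> ball b (r + \<eta>)"
      proof
        assume "y \<in> X"
        then obtain u where u: "y = u - z" "dist a u < r" by (auto simp: X_def)
        have "b - y = (a - u) + (z - (a - b))" using u(1) by simp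
        then have "norm (b - y) \<le> norm (a - u) + norm (z - (a - b))"
          using norm_triangle_ineq by metis
        also have "\<dots> < r + \<eta>"
          using u(2) z by (intro add_strict_mono) (auto simp: dist_norm norm_minus_commute)
        finally show ?thesis by (simp add: dist_norm)
      next
        assume "y \<in> Y"
        then show ?thesis using \<eta>(1) by (auto simp: Y_def)
      qed
    qed
    then have "measure lebesgue (X \<union> Y) \<le> measure lebesgue (ball b (r + \<eta>))"
      using X(1) Y(1) by (intro measure_mono_fmeasurable) auto
    also have "\<dots> = (r + \<eta>) ^ n * v" using r(1) \<eta>(1) by (intro ball_vol) auto
    also have "\<dots> < 3/2 * r ^ n * v" using \<eta>(2) v by (intro mult_strict_right_mono) auto
    finally have "measure lebesgue (X \<union> Y) < 3/2 * (r ^ n * v)" by simp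
    moreover have "measure lebesgue (X \<union> Y) = measure lebesgue X + measure lebesgue Y - measure lebesgue (X \<inter> Y)"
      using X(1) Y(1) by (rule measure_Un3)
    ultimately have pos: "measure lebesgue (X \<inter> Y) > 0"
      using X(2) Y(2) by simp
    show "emeasure lebesgue {y \<in> B. z + y \<in> A} > 0"
    proof (rule ccontr)
      assume "\<not> ?thesis"
      moreover have "{y. z + y \<in> A} = (+) (- z) ` A"
        by (auto intro!: image_eqI[where x = "z + _"])
      then have "{y \<in> B. z + y \<in> A} \<in> sets lebesgue"
        using B(1) lebesgue_sets_translation[OF A(1), of "- z"] sets.Int[of B lebesgue "{y. z + y \<in> A}"]
        by (simp add: Collect_conj_eq)
      ultimately have "negligible {y \<in> B. z + y \<in> A}"
        by (simp add: negligible_iff_emeasure0)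
      moreover have "X \<inter> Y \<subseteq> {y \<in> B. z + y \<in> A}" by (auto simp: X_def Y_def)
      ultimately have "negligible (X \<inter> Y)" using negligible_subset by blast
      then show False using pos by (simp add: negligible_imp_measure0)
    qed
  qed
qed

text \<open>The kernel may vanish on large sets, so positivity needs a whole neighbourhood of displacements with
  positive overlap: on such a neighbourhood of \<open>a - b\<close> a vanishing interaction would force \<open>K = 0\<close>
  almost everywhere.\<close>

lemma interaction_pos_if_density_points_near:
  fixes A B :: "(real ^ 'd) set"
  assumes K: "K \<in> borel_measurable lebesgue"
    and A: "A \<in> sets lebesgue" "a \<in> mt_interior A"
    and B: "B \<in> sets lebesgue" "b \<in> mt_interior B"
    and nonzero: "\<And>\<eta>. \<eta> > 0 \<Longrightarrow> \<not> (AE z in lebesgue. z \<in> ball (a - b) \<eta> \<longrightarrow> K z = 0)"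
  shows "interaction K A B \<noteq> 0"
proof
  assume "interaction K A B = 0"
  then have *: "AE z in lebesgue. K z * emeasure lebesgue {y \<in> B. z + y \<in> A} = 0"
    using interaction_eq_overlap_integral[OF K A(1) B(1)] K
    by (simp add: nn_integral_0_iff_AE)
  obtain \<eta> where \<eta>: "\<eta> > 0" "\<And>z. z \<in> ball (a - b) \<eta> \<Longrightarrow> emeasure lebesgue {y \<in> B. z + y \<in> A} > 0"
    using overlap_pos_near_difference_of_density_points[OF A B] by blast
  have "AE z in lebesgue. z \<in> ball (a - b) \<eta> \<longrightarrow> K z = 0"
    using * by eventually_elim (use \<eta>(2) in force)
  then show False using nonzero[OF \<eta>(1)] by blast
qed

section \<open>The nonlocal perimeter\<close>

text \<open>At the origin the division yields 0, so that the value there is 0; a single point carries no mass.\<close>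

definition perimeter_kernel :: "(real ^ 'd \<Rightarrow> ennreal) \<Rightarrow> real ^ 'd \<Rightarrow> ennreal" where
  "perimeter_kernel \<rho> z = ennreal (1 / norm z) * \<rho> z"

lemma borel_measurable_perimeter_kernel:
  assumes "\<rho> \<in> borel_measurable lebesgue"
  shows "perimeter_kernel \<rho> \<in> borel_measurable lebesgue"
proof -
  have "(\<lambda>z :: real ^ 'd. ennreal (1 / norm z)) \<in> borel_measurable lebesgue"
    by (intro measurable_completion) measurable
  then show ?thesis
    unfolding perimeter_kernel_def[abs_def] using assms by measurable
qed

lemma nl_perimeter_eq_interaction:
  assumes \<rho>: "\<rho> \<in> borel_measurable lebesgue" and E: "E \<in> sets lebesgue"
  shows "nl_perimeter \<rho> E = interaction (perimeter_kernel \<rho>) E (- E) + interaction (perimeter_kernel \<rho>) (- E) E"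
proof -
  let ?K = "perimeter_kernel \<rho>"
  note K = borel_measurable_perimeter_kernel[OF \<rho>]
  have E': "- E \<in> sets lebesgue" using E by (simp add: Compl_in_sets_lebesgue)
  have inner: "(\<integral>\<^sup>+x. ennreal (\<bar>indicator E x - indicator E y\<bar> / norm (x - y)) * \<rho> (x - y) \<partial>lebesgue)
      = (\<integral>\<^sup>+x\<in>E. ?K (x - y) \<partial>lebesgue) * indicator (- E) y
        + (\<integral>\<^sup>+x\<in>- E. ?K (x - y) \<partial>lebesgue) * indicator E y" for y
  proof -
    note [measurable] = borel_measurable_lebesgue_translate[OF K, of y] E E'
    have "(\<integral>\<^sup>+x. ennreal (\<bar>indicator E x - indicator E y\<bar> / norm (x - y)) * \<rho> (x - y) \<partial>lebesgue)
      = (\<integral>\<^sup>+x. ?K (x - y) * indicator E x * indicator (- E) y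
            + ?K (x - y) * indicator (- E) x * indicator E y \<partial>lebesgue)"
      by (intro nn_integral_cong) (auto simp: perimeter_kernel_def indicator_def)
    also have "\<dots> = (\<integral>\<^sup>+x. ?K (x - y) * indicator E x * indicator (- E) y \<partial>lebesgue)
            + (\<integral>\<^sup>+x. ?K (x - y) * indicator (- E) x * indicator E y \<partial>lebesgue)"
      by (intro nn_integral_add) measurable
    finally show ?thesis by (simp add: nn_integral_multc)
  qed
  note [measurable] = borel_measurable_interaction_inner[OF K E] borel_measurable_interaction_inner[OF K E'] E E'
  show ?thesis
    unfolding nl_perimeter_def inner interaction_def by (intro nn_integral_add) measurable
qed

lemma nl_perimeter_cong_AE:
  assumes \<rho>: "\<rho> \<in> borel_measurable lebesgue" and "E \<in> sets lebesgue" "E' \<in> sets lebesgue"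
    and eq: "AE x in lebesgue. x \<in> E \<longleftrightarrow> x \<in> E'"
  shows "nl_perimeter \<rho> E = nl_perimeter \<rho> E'"
proof -
  have eq': "AE x in lebesgue. x \<in> - E \<longleftrightarrow> x \<in> - E'" using eq by simp
  show ?thesis
    using assms by (simp add: nl_perimeter_eq_interaction interaction_cong_AE[OF eq eq']
        interaction_cong_AE[OF eq' eq])
qed

text \<open>The failure of additivity: separating \<open>A\<close> from \<open>B\<close> creates a common boundary, paid for once in
  each perimeter. Written with sums only, the identity also holds for infinite perimeters.\<close>

lemma nl_perimeter_add_eq:
  assumes \<rho>: "\<rho> \<in> borel_measurable lebesgue"
    and A: "A \<in> sets lebesgue" and B: "B \<in> sets lebesgue" and AB: "A \<inter> B = {}"
  shows "nl_perimeter \<rho> A + nl_perimeter \<rho> B = nl_perimeter \<rho> (A \<union> B)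
    + 2 * (interaction (perimeter_kernel \<rho>) A B + interaction (perimeter_kernel \<rho>) B A)"
proof -
  let ?J = "interaction (perimeter_kernel \<rho>)"
  note K = borel_measurable_perimeter_kernel[OF \<rho>]
  define R where "R = - (A \<union> B)"
  have R: "R \<in> sets lebesgue" "R \<inter> A = {}" "R \<inter> B = {}"
    using A B by (auto simp: R_def Compl_in_sets_lebesgue)
  have PA: "nl_perimeter \<rho> A = ?J A R + ?J A B + (?J R A + ?J B A)"
  proof -
    have "- A = R \<union> B" using AB by (auto simp: R_def)
    then show ?thesis
      using A B R AB
      by (simp add: nl_perimeter_eq_interaction[OF \<rho>] interaction_Un_left[OF K] interaction_Un_right[OF K])
  qed
  have PB: "nl_perimeter \<rho> B = ?J B R + ?J B A + (?J R B + ?J A B)"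
  proof -
    have "- B = R \<union> A" using AB by (auto simp: R_def)
    then show ?thesis
      using A B R AB
      by (simp add: nl_perimeter_eq_interaction[OF \<rho>] interaction_Un_left[OF K] interaction_Un_right[OF K])
  qed
  have PAB: "nl_perimeter \<rho> (A \<union> B) = ?J A R + ?J B R + (?J R A + ?J R B)"
  proof -
    have "- (A \<union> B) = R" by (simp add: R_def)
    moreover have "A \<union> B \<in> sets lebesgue" using A B by simp
    ultimately show ?thesis
      using A B R(1) AB
      by (simp only: nl_perimeter_eq_interaction[OF \<rho>] interaction_Un_left[OF K] interaction_Un_right[OF K])
  qed
  show ?thesis unfolding PA PB PAB by (simp add: mult_2 ac_simps)
qed

text \<open>Inside the union, a set interacts only with itself, so its interaction with its own complement is
  the interaction with the complement of the whole union; the latter is countably additive.\<close>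

lemma nl_perimeter_Union_of_far_sets:
  assumes \<rho>: "\<rho> \<in> borel_measurable lebesgue"
    and zero: "AE z in lebesgue. \<epsilon> \<le> norm z \<longrightarrow> perimeter_kernel \<rho> z = 0"
    and \<C>: "countable \<C>" "disjoint \<C>" "\<C> \<subseteq> sets lebesgue"
    and far: "\<And>C x y. C \<in> \<C> \<Longrightarrow> x \<in> C \<Longrightarrow> y \<in> \<Union>\<C> - C \<Longrightarrow> \<epsilon> \<le> dist x y"
  shows "nl_perimeter \<rho> (\<Union>\<C>) = (\<integral>\<^sup>+C. nl_perimeter \<rho> C \<partial>count_space \<C>)"
proof -
  let ?J = "interaction (perimeter_kernel \<rho>)"
  note K = borel_measurable_perimeter_kernel[OF \<rho>]
  define U where "U = \<Union>\<C>"
  have U: "U \<in> sets lebesgue" "- U \<in> sets lebesgue"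
    using \<C>(1,3) unfolding U_def by (auto simp: Compl_in_sets_lebesgue intro!: sets.countable_Union)
  have "nl_perimeter \<rho> C = ?J C (- U) + ?J (- U) C" if C: "C \<in> \<C>" for C
  proof -
    have C_sets: "C \<in> sets lebesgue" "U - C \<in> sets lebesgue" using C \<C>(3) U(1) by auto
    have compl: "- C = - U \<union> (U - C)" "- U \<inter> (U - C) = {}" using C by (auto simp: U_def)
    have far': "\<epsilon> \<le> dist x y" "\<epsilon> \<le> dist y x" if "x \<in> C" "y \<in> U - C" for x y
      using far[OF C, of x y] that by (simp_all add: U_def dist_commute)
    have "?J C (U - C) = 0" "?J (U - C) C = 0"
      by (rule interaction_eq_0_if_far[OF zero], erule (1) far')+
    then show ?thesis
      using C_sets U compl(2)
      by (simp add: nl_perimeter_eq_interaction[OF \<rho>] compl(1) interaction_Un_left[OF K] interaction_Un_right[OF K])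
  qed
  then have "(\<integral>\<^sup>+C. nl_perimeter \<rho> C \<partial>count_space \<C>)
      = (\<integral>\<^sup>+C. ?J C (- U) \<partial>count_space \<C>) + (\<integral>\<^sup>+C. ?J (- U) C \<partial>count_space \<C>)"
    by (simp add: nn_integral_add cong: nn_integral_cong_simp)
  also have "\<dots> = ?J U (- U) + ?J (- U) U"
    using interaction_Union_left[OF K \<C> U(2)] interaction_Union_right[OF K \<C> U(2)] by (simp add: U_def)
  also have "\<dots> = nl_perimeter \<rho> U" using U(1) by (simp add: nl_perimeter_eq_interaction[OF \<rho>])
  finally show ?thesis by (simp add: U_def)
qed

lemma infsum_eq_nn_integral_count_space:
  fixes f :: "'a \<Rightarrow> ennreal"
  assumes "countable A"
  shows "infsum f A = (\<integral>\<^sup>+x. f x \<partial>count_space A)"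
proof (cases "finite A")
  case True
  then show ?thesis by (simp add: nn_integral_count_space_finite)
next
  case False
  note bij = bij_betw_from_nat_into[OF assms False]
  have "((\<lambda>n. f (from_nat_into A n)) has_sum infsum (\<lambda>n. f (from_nat_into A n)) UNIV) UNIV"
    by (intro has_sum_infsum nonneg_summable_on_complete) simp
  then have "infsum (\<lambda>n. f (from_nat_into A n)) UNIV = (\<Sum>n. f (from_nat_into A n))"
    using has_sum_imp_sums sums_unique by blast
  then show ?thesis
    using infsum_reindex_bij_betw[OF bij, of f] nn_integral_bij_count_space[OF bij, of f]
    by (simp add: nn_integral_count_space_nat)
qed

section \<open>Connected components\<close>

text \<open>Chains become the reflexive transitive closure of one symmetric relation, which provides
  concatenation, reversal and induction along chains. The first conjunct is needed for chains of
  length zero.\<close>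

lemma eps_connected_iff_rtrancl:
  "eps_connected \<epsilon> E x y \<longleftrightarrow> x \<in> mt_interior E \<and>
    (x, y) \<in> {(u, v). u \<in> mt_interior E \<and> v \<in> mt_interior E \<and> norm (u - v) < \<epsilon>}\<^sup>*"
  (is "_ \<longleftrightarrow> _ \<and> _ \<in> ?R\<^sup>*")
proof
  assume "eps_connected \<epsilon> E x y"
  then obtain N z where z: "\<forall>i\<le>N. z i \<in> mt_interior E" "z 0 = x" "z N = y" "\<forall>i<N. norm (z i - z (Suc i)) < \<epsilon>"
    unfolding eps_connected_def by blast
  then have "(x, y) \<in> ?R ^^ N"
    unfolding relpow_fun_conv by (intro exI[of _ z]) auto
  then have "(x, y) \<in> ?R\<^sup>*" by (rule relpow_imp_rtrancl)
  then show "x \<in> mt_interior E \<and> (x, y) \<in> ?R\<^sup>*" using z(1,2) by auto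
next
  assume xy: "x \<in> mt_interior E \<and> (x, y) \<in> ?R\<^sup>*"
  then obtain N where "(x, y) \<in> ?R ^^ N" by (auto dest: rtrancl_imp_relpow)
  then obtain z where z: "z 0 = x" "z N = y" "\<forall>i<N. (z i, z (Suc i)) \<in> ?R"
    unfolding relpow_fun_conv by blast
  have "z i \<in> mt_interior E" if "i \<le> N" for i
    using that z xy by (cases i) (auto simp: Suc_le_eq)
  then show "eps_connected \<epsilon> E x y"
    using z unfolding eps_connected_def by (intro exI[of _ N] exI[of _ z]) auto
qed

lemma eps_component_subset: "eps_component \<epsilon> E x \<subseteq> mt_interior E"
  by (auto simp: eps_component_def)

lemma eps_component_refl: "x \<in> mt_interior E \<Longrightarrow> x \<in> eps_component \<epsilon> E x"
  by (simp add: eps_component_def eps_connected_iff_rtrancl)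

lemma eps_component_step:
  assumes "u \<in> eps_component \<epsilon> E x" "v \<in> mt_interior E" "dist u v < \<epsilon>"
  shows "v \<in> eps_component \<epsilon> E x"
  using assms
  by (auto simp: eps_component_def eps_connected_iff_rtrancl dist_norm norm_minus_commute
      intro: converse_rtrancl_into_rtrancl)

lemma eps_component_eq:
  assumes "u \<in> eps_component \<epsilon> E x"
  shows "eps_component \<epsilon> E u = eps_component \<epsilon> E x"
proof -
  let ?R = "{(u, v). u \<in> mt_interior E \<and> v \<in> mt_interior E \<and> norm (u - v) < \<epsilon>}"
  have "sym ?R" by (auto simp: sym_def norm_minus_commute)
  then have "sym (?R\<^sup>*)" by (rule sym_rtrancl)
  moreover have ux: "(u, x) \<in> ?R\<^sup>*"
    using assms by (simp add: eps_component_def eps_connected_iff_rtrancl)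
  ultimately have xu: "(x, u) \<in> ?R\<^sup>*" by (rule symD)
  show ?thesis
    unfolding eps_component_def eps_connected_iff_rtrancl
    using rtrancl_trans[OF _ ux] rtrancl_trans[OF _ xu] by blast
qed

lemma eps_components_unique:
  assumes "C \<in> eps_components \<epsilon> E" "D \<in> eps_components \<epsilon> E" "u \<in> C" "u \<in> D"
  shows "C = D"
  using assms eps_component_eq unfolding eps_components_def by blast

lemma disjoint_eps_components: "disjoint (eps_components \<epsilon> E)"
  using eps_components_unique by (metis disjointI disjoint_iff)

lemma Union_eps_components: "\<Union>(eps_components \<epsilon> E) = mt_interior E"
  using eps_component_refl eps_component_subset by (auto simp: eps_components_def) blast

lemma eps_components_far:
  assumes "C \<in> eps_components \<epsilon> E" "u \<in> C" "v \<in> mt_interior E - C"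
  shows "\<epsilon> \<le> dist u v"
  using assms eps_component_step[of u \<epsilon> E _ v] by (force simp: eps_components_def)

lemma eps_component_chain_induct:
  assumes C: "C \<in> eps_components \<epsilon> E" and u: "u \<in> C" "P u" and v: "v \<in> C"
    and step: "\<And>w w'. w \<in> C \<Longrightarrow> w' \<in> C \<Longrightarrow> dist w w' < \<epsilon> \<Longrightarrow> P w \<Longrightarrow> P w'"
  shows "P v"
proof -
  let ?R = "{(u, v). u \<in> mt_interior E \<and> v \<in> mt_interior E \<and> norm (u - v) < \<epsilon>}"
  obtain x where x: "C = eps_component \<epsilon> E x" using C by (auto simp: eps_components_def)
  have "u \<in> eps_component \<epsilon> E v"
    using eps_component_eq[of v \<epsilon> E x] u(1) v x by simp
  then have "(u, v) \<in> ?R\<^sup>*" by (simp add: eps_component_def eps_connected_iff_rtrancl)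
  then have "v \<in> C \<and> P v"
  proof (induction rule: rtrancl_induct)
    case base
    then show ?case using u by simp
  next
    case (step w w')
    then have "w' \<in> C" using eps_component_step[of w \<epsilon> E x w'] by (simp add: x dist_norm)
    then show ?case using step assms(5)[of w w'] by (simp add: dist_norm)
  qed
  then show ?thesis ..
qed

lemma eps_component_Int_ball:
  assumes "C \<in> eps_components \<epsilon> E" "u \<in> C" "r \<le> \<epsilon>"
  shows "C \<inter> ball u r = mt_interior E \<inter> ball u r"
  using eps_components_far[OF assms(1,2)] Union_eps_components[of \<epsilon> E] assms by force

lemma eps_components_measurable:
  assumes \<epsilon>: "\<epsilon> > 0" and E: "E \<in> sets lebesgue" and C: "C \<in> eps_components \<epsilon> E"
  shows "C \<in> sets lebesgue"
proof -
  have "C = mt_interior E \<inter> (\<Union>u\<in>C. ball u \<epsilon>)"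
    using eps_component_Int_ball[OF C _ order_refl] Union_eps_components[of \<epsilon> E] C \<epsilon> by fastforce
  moreover have "(\<Union>u\<in>C. ball u \<epsilon>) \<in> sets lebesgue"
    by (intro borel_open[THEN sets_completionI_sets[of _ lborel, simplified]] open_UN) auto
  ultimately show ?thesis using mt_interior_in_sets_lebesgue[OF E] by (metis sets.Int)
qed

text \<open>Thickened by \<open>\<epsilon> / 2\<close>, distinct components become disjoint nonempty open sets.\<close>

lemma countable_eps_components:
  assumes \<epsilon>: "\<epsilon> > 0"
  shows "countable (eps_components \<epsilon> E)"
proof -
  let ?U = "\<lambda>C. \<Union>u\<in>C. ball u (\<epsilon> / 2)"
  have inter: "C = D" if CD: "C \<in> eps_components \<epsilon> E" "D \<in> eps_components \<epsilon> E" and meet: "?U C \<inter> ?U D \<noteq> {}" for C D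
  proof -
    obtain u v w where w: "u \<in> C" "v \<in> D" "dist u w < \<epsilon> / 2" "dist v w < \<epsilon> / 2"
      using meet by auto
    then have "dist u v < \<epsilon>" using dist_triangle_half_l by blast
    moreover have "v \<in> mt_interior E" using CD(2) w(2) Union_eps_components by blast
    ultimately have "v \<in> C" using eps_components_far[OF CD(1) w(1), of v] by auto
    then show ?thesis using eps_components_unique CD w(2) by blast
  qed
  have nonempty: "C \<noteq> {}" if "C \<in> eps_components \<epsilon> E" for C
    using that eps_component_refl by (auto simp: eps_components_def)
  have "countable (?U ` eps_components \<epsilon> E)"
  proof (rule countable_disjoint_open_subsets)
    show "disjoint (?U ` eps_components \<epsilon> E)"
    proof (rule disjointI, elim imageE)
      fix S T C D assume "S \<noteq> T" and CD: "S = ?U C" "C \<in> eps_components \<epsilon> E" "T = ?U D" "D \<in> eps_components \<epsilon> E"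
      then have "C \<noteq> D" by blast
      then show "S \<inter> T = {}" using inter[OF CD(2,4)] CD(1,3) by argo
    qed
  qed auto
  moreover have "inj_on ?U (eps_components \<epsilon> E)"
  proof (rule inj_onI)
    fix C D assume CD: "C \<in> eps_components \<epsilon> E" "D \<in> eps_components \<epsilon> E" and eq: "?U C = ?U D"
    have "?U C \<noteq> {}" using nonempty[OF CD(1)] \<epsilon> by auto
    then show "C = D" using inter[OF CD] eq by simp
  qed
  ultimately show ?thesis by (rule countable_image_inj_on)
qed

text \<open>Within distance \<open>\<epsilon>\<close> of one of its points a component coincides with the whole measure-theoretic
  interior, so it inherits the positive density of \<open>E\<close> there.\<close>

lemma eps_component_Int_ball_pos:
  assumes \<epsilon>: "\<epsilon> > 0" and E: "E \<in> sets lebesgue" and C: "C \<in> eps_components \<epsilon> E"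
    and u: "u \<in> C" and r: "r > 0"
  shows "emeasure lebesgue (C \<inter> ball u r) > 0"
proof -
  have "u \<in> mt_interior E" using C u Union_eps_components by blast
  then obtain \<delta> where \<delta>: "\<delta> > 0"
    "\<And>r. 0 < r \<Longrightarrow> r < \<delta> \<Longrightarrow> 0 * measure lebesgue (ball u r) < measure lebesgue (E \<inter> ball u r)"
    by (rule density_gt_at_mt_interior[where t = 0]) auto
  \<comment> \<open>The radius must be below \<open>\<delta>\<close> for the density and at most \<open>\<epsilon>\<close> to stay inside the component.\<close>
  define s where "s = min (\<delta> / 2) (min r \<epsilon>)"
  have s: "0 < s" "s < \<delta>" "s \<le> r" "s \<le> \<epsilon>" using \<delta>(1) r \<epsilon> by (auto simp: s_def)
  have "0 < measure lebesgue (E \<inter> ball u s)" using \<delta>(2)[OF s(1,2)] by simp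
  then have "0 < emeasure lebesgue (E \<inter> ball u s)" by (simp add: measure_def zero_less_iff_neq_zero) (metis enn2real_0 less_irrefl)
  also have "\<dots> = emeasure lebesgue (mt_interior E \<inter> ball u s)"
    using AE_mem_mt_interior_iff[OF E] E mt_interior_in_sets_lebesgue[OF E]
    by (intro emeasure_eq_AE) auto
  also have "mt_interior E \<inter> ball u s = C \<inter> ball u s"
    using eps_component_Int_ball[OF C u s(4)] by simp
  also have "emeasure lebesgue (C \<inter> ball u s) \<le> emeasure lebesgue (C \<inter> ball u r)"
    using s(3) eps_components_measurable[OF \<epsilon> E C] by (intro emeasure_mono) auto
  finally show ?thesis .
qed

text \<open>The essential support yields this for \<open>\<epsilon> < norm z\<close>; the sphere itself is a null set.\<close>

lemma perimeter_kernel_eq_0_outside: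
  assumes "ess_support \<rho> = cball 0 \<epsilon>"
  shows "AE z in lebesgue. \<epsilon> \<le> norm z \<longrightarrow> perimeter_kernel \<rho> z = 0"
proof -
  have "AE z in lebesgue. z \<notin> cball 0 \<epsilon> \<longrightarrow> \<rho> z = 0"
    using ess_support_least(2)[of \<rho>] assms by simp
  moreover have "AE z in lebesgue. z \<notin> sphere (0 :: real ^ 'd) \<epsilon>"
    using negligible_sphere[of "0 :: real ^ 'd" \<epsilon>]
    by (intro AE_not_in) (simp add: negligible_iff_null_sets)
  ultimately show ?thesis
    by eventually_elim (auto simp: perimeter_kernel_def)
qed

text \<open>All that an essential support says from inside: the kernel may vanish on sets of positive measure,
  but not almost everywhere on a ball around a point of the support.\<close>

lemma perimeter_kernel_nonzero_inside:
  fixes z0 :: "real ^ 'd"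
  assumes "ess_support \<rho> = cball 0 \<epsilon>" and z0: "norm z0 \<le> \<epsilon>" and "\<eta> > 0"
  shows "\<not> (AE z in lebesgue. z \<in> ball z0 \<eta> \<longrightarrow> perimeter_kernel \<rho> z = 0)"
proof
  assume "AE z in lebesgue. z \<in> ball z0 \<eta> \<longrightarrow> perimeter_kernel \<rho> z = 0"
  moreover have "AE z in lebesgue. z \<noteq> (0 :: real ^ 'd)"
    using AE_lborel_singleton[of 0] by (rule AE_completion)
  ultimately have "AE z in lebesgue. z \<notin> - ball z0 \<eta> \<longrightarrow> \<rho> z = 0"
    by eventually_elim (auto simp: perimeter_kernel_def)
  then have "cball 0 \<epsilon> \<subseteq> - ball z0 \<eta>"
    using ess_support_least(3)[of "- ball z0 \<eta>" \<rho>] assms(1) by (simp add: closed_Compl)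
  moreover have "z0 \<in> cball 0 \<epsilon>" "z0 \<in> ball z0 \<eta>" using z0 \<open>\<eta> > 0\<close> by auto
  ultimately show False by blast
qed

text \<open>Suppose \<open>E1\<close> and \<open>E2\<close> decompose the component \<open>C\<close>. Then they do not interact, so their density points
  are at distance at least \<open>\<epsilon>\<close>, and so are the closures \<open>D1\<close>, \<open>D2\<close> of the sets of density points. These
  closures cover \<open>C\<close>, because \<open>C\<close> has positive measure near each of its points. A step of length
  less than \<open>\<epsilon>\<close> inside \<open>C\<close> therefore cannot leave \<open>D1\<close>, and a chain from a density point of \<open>E1\<close> to one
  of \<open>E2\<close> gives a contradiction.\<close>

lemma indecomposable_eps_component:
  fixes \<rho> :: "real ^ 'd \<Rightarrow> ennreal"
  assumes \<epsilon>: "\<epsilon> > 0" and \<rho>: "\<rho> \<in> borel_measurable lebesgue" and supp: "ess_support \<rho> = cball 0 \<epsilon>"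
    and E: "E \<in> sets lebesgue" and C: "C \<in> eps_components \<epsilon> E" and fin: "finite_perimeter \<rho> C"
  shows "indecomposable \<rho> C"
proof -
  let ?K = "perimeter_kernel \<rho>"
  have impossible: False if part: "E1 \<union> E2 = C" "E1 \<inter> E2 = {}"
    and fin12: "finite_perimeter \<rho> E1" "finite_perimeter \<rho> E2"
    and pos: "emeasure lebesgue E1 > 0" "emeasure lebesgue E2 > 0"
    and add: "nl_perimeter \<rho> C = nl_perimeter \<rho> E1 + nl_perimeter \<rho> E2" for E1 E2
  proof -
    have sets12: "E1 \<in> sets lebesgue" "E2 \<in> sets lebesgue"
      using fin12 by (auto simp: finite_perimeter_def)
    have "nl_perimeter \<rho> C = nl_perimeter \<rho> C + 2 * (interaction ?K E1 E2 + interaction ?K E2 E1)"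
      using nl_perimeter_add_eq[OF \<rho> sets12 part(2)] add part(1) by simp
    then have "0 = 2 * (interaction ?K E1 E2 + interaction ?K E2 E1)"
      using fin ennreal_add_left_cancel[of "nl_perimeter \<rho> C" 0 "2 * (interaction ?K E1 E2 + interaction ?K E2 E1)"]
      by (auto simp: finite_perimeter_def)
    then have no_interaction: "interaction ?K E1 E2 = 0" by simp
    have far: "\<epsilon> \<le> dist a b" if a: "a \<in> mt_interior E1" and b: "b \<in> mt_interior E2" for a b
    proof (rule ccontr)
      assume "\<not> \<epsilon> \<le> dist a b"
      then have "norm (a - b) \<le> \<epsilon>" by (simp add: dist_norm)
      then have "interaction ?K E1 E2 \<noteq> 0"
        by (intro interaction_pos_if_density_points_near[OF borel_measurable_perimeter_kernel[OF \<rho>]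
              sets12(1) a sets12(2) b] perimeter_kernel_nonzero_inside[OF supp])
      then show False using no_interaction by simp
    qed
    define D1 where "D1 = closure (mt_interior E1)"
    define D2 where "D2 = closure (mt_interior E2)"
    have far_closure: "\<epsilon> \<le> dist a b" if a: "a \<in> D1" and b: "b \<in> D2" for a b
    proof (rule field_le_epsilon)
      fix e :: real assume "e > 0"
      then obtain a' b' where a': "a' \<in> mt_interior E1" "dist a' a < e / 2"
          and b': "b' \<in> mt_interior E2" "dist b' b < e / 2"
        using a b unfolding D1_def D2_def closure_approachable by (meson half_gt_zero)
      have "\<epsilon> \<le> dist a' b'" using far[OF a'(1) b'(1)] .
      also have "\<dots> \<le> dist a' a + (dist a b + dist b' b)"
        using dist_triangle[of a' b' a] dist_triangle[of a b' b] dist_commute[of b b'] by linarith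
      finally show "\<epsilon> \<le> dist a b + e" using a'(2) b'(2) by simp
    qed
    have cover: "u \<in> D1 \<union> D2" if u: "u \<in> C" for u
    proof (rule ccontr)
      assume "u \<notin> D1 \<union> D2"
      then have "open (- (D1 \<union> D2))" "u \<in> - (D1 \<union> D2)"
        by (auto simp: D1_def D2_def intro!: open_Compl closed_Un)
      then obtain r where r: "r > 0" "ball u r \<subseteq> - (D1 \<union> D2)"
        by (meson open_contains_ball)
      have "C \<inter> ball u r = (E1 \<inter> ball u r) \<union> (E2 \<inter> ball u r)" using part(1) by auto
      then have "\<not> (E1 \<inter> ball u r \<in> null_sets lebesgue \<and> E2 \<inter> ball u r \<in> null_sets lebesgue)"
        using eps_component_Int_ball_pos[OF \<epsilon> E C u r(1)]
          null_sets.Un[of "E1 \<inter> ball u r" lebesgue "E2 \<inter> ball u r"]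
        by (metis null_setsD1 less_irrefl)
      moreover have "E1 \<inter> ball u r \<in> sets lebesgue" "E2 \<inter> ball u r \<in> sets lebesgue"
        using sets12 by auto
      ultimately consider "emeasure lebesgue (E1 \<inter> ball u r) > 0" | "emeasure lebesgue (E2 \<inter> ball u r) > 0"
        unfolding zero_less_iff_neq_zero by (meson null_setsI)
      then obtain x where x: "x \<in> ball u r" "x \<in> mt_interior E1 \<union> mt_interior E2"
      proof cases
        case 1
        obtain y where "y \<in> ball u r" "y \<in> mt_interior E1"
          using ex_density_point[OF sets12(1) 1] .
        then show thesis using that[of y] by simp
      next
        case 2
        obtain y where "y \<in> ball u r" "y \<in> mt_interior E2"
          using ex_density_point[OF sets12(2) 2] .
        then show thesis using that[of y] by simp
      qed
      then have "x \<in> D1 \<union> D2" using closure_subset unfolding D1_def D2_def by blast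
      then show False using r(2) x(1) by blast
    qed
    obtain a where a: "a \<in> E1" "a \<in> mt_interior E1"
      using ex_density_point[OF sets12(1), of UNIV] pos(1) by auto
    obtain b where b: "b \<in> E2" "b \<in> mt_interior E2"
      using ex_density_point[OF sets12(2), of UNIV] pos(2) by auto
    have "b \<in> D1"
    proof (rule eps_component_chain_induct[OF C, of a "\<lambda>u. u \<in> D1"])
      show "a \<in> C" "b \<in> C" using a(1) b(1) part(1) by auto
      show "a \<in> D1" using a(2) closure_subset unfolding D1_def by blast
      fix w w' assume "w \<in> C" "w' \<in> C" "dist w w' < \<epsilon>" "w \<in> D1"
      then show "w' \<in> D1" using cover[of w'] far_closure[of w w'] by (meson UnE not_le)
    qed
    moreover have "b \<in> D2" using b(2) closure_subset unfolding D2_def by blast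
    ultimately show False using far_closure[of b b] \<epsilon> by simp
  qed
  have "\<not> decomposable \<rho> C" 
  proof (intro notI)
    assume "decomposable \<rho> C"
    then show False unfolding decomposable_def using impossible by (elim conjE exE)
  qed
  then show ?thesis using fin by (simp add: indecomposable_def)
qed

theorem theorem2p9:
  fixes \<epsilon> :: real and \<rho> :: "real ^ 'd \<Rightarrow> ennreal" and E :: "(real ^ 'd) set"
  assumes "\<epsilon> > 0"
    and "\<rho> \<in> borel_measurable lebesgue"
    and "ess_support \<rho> = cball 0 \<epsilon>"
    and "E \<in> sets lebesgue"
    and "nl_perimeter \<rho> E < \<infinity>"
  shows "\<exists>!\<C>. countable \<C> \<and> \<C> \<subseteq> eps_components \<epsilon> E \<and>
    (\<forall>C\<in>\<C>. indecomposable \<rho> C \<and> emeasure lebesgue C > 0) \<and>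
    \<Union>\<C> = mt_interior E \<and>
    nl_perimeter \<rho> E = infsum (nl_perimeter \<rho>) \<C>"
proof -
  let ?\<C> = "eps_components \<epsilon> E"
  note \<epsilon> = assms(1) and \<rho> = assms(2) and supp = assms(3) and E = assms(4)
  have countable: "countable ?\<C>" using countable_eps_components[OF \<epsilon>] .
  have sets: "?\<C> \<subseteq> sets lebesgue" using eps_components_measurable[OF \<epsilon> E] by blast
  \<comment> \<open>The components partition the measure-theoretic interior, which differs from \<open>E\<close> by a null set.\<close>
  have "nl_perimeter \<rho> E = nl_perimeter \<rho> (\<Union>?\<C>)"
    unfolding Union_eps_components using AE_mem_mt_interior_iff[OF E] E mt_interior_in_sets_lebesgue[OF E]
    by (intro nl_perimeter_cong_AE[OF \<rho>]) (auto elim!: eventually_mono)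
  also have "\<dots> = (\<integral>\<^sup>+C. nl_perimeter \<rho> C \<partial>count_space ?\<C>)"
  proof (rule nl_perimeter_Union_of_far_sets[OF \<rho> perimeter_kernel_eq_0_outside[OF supp]
        countable disjoint_eps_components sets])
    fix C x y assume "C \<in> ?\<C>" "x \<in> C" "y \<in> \<Union>?\<C> - C"
    then show "\<epsilon> \<le> dist x y"
      unfolding Union_eps_components by (rule eps_components_far)
  qed
  finally have sum: "nl_perimeter \<rho> E = (\<integral>\<^sup>+C. nl_perimeter \<rho> C \<partial>count_space ?\<C>)" .
  have indec: "indecomposable \<rho> C" if C: "C \<in> ?\<C>" for C
  proof -
    have "nl_perimeter \<rho> C \<le> nl_perimeter \<rho> E"
      unfolding sum by (rule nn_integral_ge_point[OF C])
    then have "finite_perimeter \<rho> C"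
      using assms(5) sets C by (auto simp: finite_perimeter_def)
    then show ?thesis by (rule indecomposable_eps_component[OF \<epsilon> \<rho> supp E C])
  qed
  have pos: "emeasure lebesgue C > 0" if C: "C \<in> ?\<C>" for C
  proof -
    obtain x where "x \<in> C" using C eps_component_refl by (auto simp: eps_components_def)
    then have "0 < emeasure lebesgue (C \<inter> ball x 1)"
      using eps_component_Int_ball_pos[OF \<epsilon> E C] by simp
    also have "\<dots> \<le> emeasure lebesgue C" using sets C by (intro emeasure_mono) auto
    finally show ?thesis .
  qed
  \<comment> \<open>Components are disjoint and nonempty, so omitting one would leave part of the interior uncovered.\<close>
  have unique: "\<C> = ?\<C>" if sub: "\<C> \<subseteq> ?\<C>" and union: "\<Union>\<C> = mt_interior E" for \<C>
  proof
    show "?\<C> \<subseteq> \<C>"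
    proof
      fix C assume C: "C \<in> ?\<C>"
      then obtain x where x: "x \<in> C" using eps_component_refl by (auto simp: eps_components_def)
      then obtain D where "D \<in> \<C>" "x \<in> D" using C union Union_eps_components by blast
      then show "C \<in> \<C>" using eps_components_unique[OF C _ x] sub by blast
    qed
  qed (fact sub)
  show ?thesis
  proof (rule ex1I[of _ ?\<C>])
    show "countable ?\<C> \<and> ?\<C> \<subseteq> ?\<C> \<and> (\<forall>C\<in>?\<C>. indecomposable \<rho> C \<and> emeasure lebesgue C > 0) \<and>
        \<Union>?\<C> = mt_interior E \<and> nl_perimeter \<rho> E = infsum (nl_perimeter \<rho>) ?\<C>"
      using countable indec pos Union_eps_components sum infsum_eq_nn_integral_count_space[OF countable, of "nl_perimeter \<rho>"]
      by simp
  next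
    fix \<C> assume "countable \<C> \<and> \<C> \<subseteq> ?\<C> \<and> (\<forall>C\<in>\<C>. indecomposable \<rho> C \<and> emeasure lebesgue C > 0) \<and>
        \<Union>\<C> = mt_interior E \<and> nl_perimeter \<rho> E = infsum (nl_perimeter \<rho>) \<C>"
    then show "\<C> = ?\<C>" by (intro unique) simp_all
  qed
qed

end
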